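(* Let $\mathcal A=\{a_1,\dots,a_m\}\subset\mathbb R^n$ be a finite nonempty set, let $\mathcal M=\mathrm{conv}(\mathcal A)$, and let $f:\mathbb R^n\to\mathbb R$ be continuously differentiable. Let $\{x^k\}_{k\ge0}$ be a sequence of points produced by the Optimize, Refine & Drop (ORD) algorithm (defined in the context) applied to $\min_{x\in\mathcal M}f(x)$, where at every iteration $$\mathcal D^k=\{a\in\mathcal A^k:\ a=A^ke_h,\ \bar y^k_h=0\ \text{and}\ (g^k)^T(e_h-\bar y^k)\ge0\},$$ with $g^k\in\mathbb R^{|\mathcal A^k|}$ satisfying $\|\nabla\varphi^k(\bar y^k)-g^k\|\le r^k$ for all $k$, where $\{r^k\}$ is a sequence of positive scalars converging to zero and $\varphi^k(y)=f(A^ky)$. Assume that $\lim_{k\to\infty}x^k=x^*$. Then there exists an iteration $\bar k$ such that, for all $k\ge\bar k$ and all $a\in\mathcal A$, $$\nabla f(x^* )^T(a-x^* )>0\ \Rightarrow\ a\notin\mathcal A^k.$$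
   Context: Notation. $\|\cdot\|$ is the Euclidean norm. $\Delta_{p-1}=\{w\in\mathbb R^p: e^Tw=1,\ w\ge 0\}$, where $e$ is the all-ones vector; $e_i$ is the $i$-th canonical basis vector. Line Search Procedure$(z,d,\hat\alpha,\gamma,\delta)$ for $\varphi$ on $\Delta_{p-1}$: (1) Compute the largest $\bar\alpha$ with $z+\bar\alpha d\in\Delta_{p-1}$ and set $\alpha=\min\{\bar\alpha,\hat\alpha\}$. (2) If $\alpha>0$ and $\varphi(z+\alpha d)\le\varphi(z)-\gamma\alpha^2$, go to (6). (3) Compute the largest $\bar\alpha$ with $z-\bar\alpha d\in\Delta_{p-1}$ and set $\alpha=\min\{\bar\alpha,\hat\alpha\}$. (4) If $\alpha>0$ and $\varphi(z-\alpha d)\le\varphi(z)-\gamma\alpha^2$, set $d=-d$ and go to (6). (5) Set $\alpha=0$ and go to (8). (6) Let $\beta=\min\{\bar\alpha,\alpha/\delta\}$. (7) While $\alpha<\bar\alpha$ and $\varphi(z+\beta d)\le\varphi(z)-\gamma\beta^2$: set $\alpha=\beta$ and then $\beta=\min\{\bar\alpha,\alpha/\delta\}$. (8) Return $\alpha,d$. Algorithm DF-SIMPLEX with tolerance $\epsilon>0$, for $\min_{y\in\Delta_{p-1}}\varphi(y)$ with $\varphi:\mathbb R^p\to\mathbb R$ continuously differentiable. Input: $y^0\in\Delta_{p-1}$, $\tau\in(0,1]$, $\theta\in(0,1)$, $\gamma>0$, $\delta\in(0,1)$, $\hat\alpha^0_1,\dots,\hat\alpha^0_p>0$. At each iteration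 $l=0,1,\dots$: choose $j_l$ with $y^l_{j_l}\ge\tau\max_i y^l_i$; set $z^l_1=y^l$. For $i=1,\dots,p$: if $i\ne j_l$, compute $\alpha,d$ by Line Search Procedure$(z^l_i,e_i-e_{j_l},\hat\alpha^l_i,\gamma,\delta)$, and set $\hat\alpha^{l+1}_i=\max\{\theta\hat\alpha^l_i,\epsilon\}$ if $\alpha=0$, $\hat\alpha^{l+1}_i=\alpha$ otherwise; if $i=j_l$, set $\alpha=0$, $d=0$. Set $\alpha^l_i=\alpha$, $d^l_i=d$, $z^l_{i+1}=z^l_i+\alpha^l_id^l_i$. After the loop on $i$, set $\hat\alpha^{l+1}_{j_l}=\min\bigl(\{\hat\alpha^{l+1}_i: i\ne j_l\}\cup\{\hat\alpha^l_{j_l}\}\bigr)$ and $y^{l+1}=z^l_{p+1}$. The algorithm stops and returns $y^l$ at the first iteration $l$ such that $\hat\alpha^l_i=\epsilon$ for all $i\in\{1,\dots,p\}$ and $\alpha^l_i=0$ for all $i\ne j_l$. ORD algorithm. Choose positive scalars $\epsilon^k$ decreasing to $0$, $\mathcal A^0\subseteq\mathcal A$, $a_{i_0}\in\mathcal A^0$; set $x^0=a_{i_0}$, $y^0=e_{i_0}\in\mathbb R^{|\mathcal A^0|}$ (the basis vector corresponding to the atom $a_{i_0}$); choose $\hat\mu^0\in(0,1)$, $\gamma>0$, $\theta\in(0,1)$ ($\gamma,\theta$ may differ from the ones used inside DF-SIMPLEX). For $k=0,1,\dots$: Optimize phase: let $A^k$ be the matrix whose columns are the atoms in $\mathcal A^k$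 (so $x^k=A^ky^k$); run DF-SIMPLEX from $y^k$ with tolerance $\epsilon^k$ on $\min_{y\in\Delta_{|\mathcal A^k|-1}}\varphi^k(y)$, $\varphi^k(y)=f(A^ky)$, let $\bar y^k$ be the returned point and set $\bar x^k=A^k\bar y^k$. Refine phase: if there exist $a_{i_k}\in\mathcal A\setminus\mathcal A^k$ and $\mu^k\in[\hat\mu^k,1]$ with $f(\bar x^k+\mu^k(a_{i_k}-\bar x^k))\le f(\bar x^k)-\gamma(\mu^k)^2$, then set $x^{k+1}=\bar x^k+\mu^k(a_{i_k}-\bar x^k)$, $\mathcal R^k=\{a_{i_k}\}$, $\hat\mu^{k+1}=\hat\mu^k$ for one such choice; otherwise set $x^{k+1}=\bar x^k$, $\mathcal R^k=\emptyset$, $\hat\mu^{k+1}=\theta\hat\mu^k$. Drop phase: choose a subset $\mathcal D^k\subseteq\{a\in\mathcal A^k: a=A^ke_h \text{ and } \bar y^k_h=0\}$ (the specific choice is prescribed in the claim); let $\mathcal A^{k+1}=(\mathcal A^k\cup\mathcal R^k)\setminus\mathcal D^k$ and choose $y^{k+1}\in\Delta_{|\mathcal A^{k+1}|-1}$ such that $x^{k+1}=A^{k+1}y^{k+1}$. Conventions: the DF-SIMPLEX parameters $\tau,\theta,\gamma,\delta$ are the same for all $k$; each inner run of DF-SIMPLEX is finite and returns $\bar y^k$ (if $|\mathcal A^k|=1$ the feasible set is a single point and $\bar y^k=y^k$). *)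

theory Defs
  imports "HOL-Analysis.Analysis"
begin

section \<open>Vectors of variable dimension\<close>

text \<open>
  The dimension \<open>p\<close> changes along the outer iterations, so a vector of \<open>\<real>\<^sup>p\<close> is a function
  \<open>nat \<Rightarrow> real\<close> of which only the coordinates \<open>0, \<dots>, p - 1\<close> are relevant. Points of the
  simplex vanish outside of these, hence equal points are equal functions.
\<close>

definition prob_simplex :: "nat \<Rightarrow> (nat \<Rightarrow> real) set" where
  "prob_simplex p = {w. (\<Sum>i<p. w i) = 1 \<and> (\<forall>i<p. 0 \<le> w i) \<and> (\<forall>i\<ge>p. w i = 0)}"

definition basis_vec :: "nat \<Rightarrow> nat \<Rightarrow> real" where
  "basis_vec i = (\<lambda>h. if h = i then 1 else 0)"

definition move :: "(nat \<Rightarrow> real) \<Rightarrow> real \<Rightarrow> (nat \<Rightarrow> real) \<Rightarrow> (nat \<Rightarrow> real)" where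
  "move z \<alpha> d = (\<lambda>h. z h + \<alpha> * d h)"

definition grad :: "((nat \<Rightarrow> real) \<Rightarrow> real) \<Rightarrow> (nat \<Rightarrow> real) \<Rightarrow> (nat \<Rightarrow> real)" where
  "grad \<phi> y = (\<lambda>h. deriv (\<lambda>t. \<phi> (y(h := t))) (y h))"

text \<open>The product \<open>A y\<close>, where the matrix \<open>A\<close> is given by the list of its columns.\<close>

definition mat_vec :: "'a::real_vector list \<Rightarrow> (nat \<Rightarrow> real) \<Rightarrow> 'a" where
  "mat_vec cs y = (\<Sum>h<length cs. y h *\<^sub>R (cs ! h))"

section \<open>Line search procedure\<close>

definition max_step :: "nat \<Rightarrow> (nat \<Rightarrow> real) \<Rightarrow> (nat \<Rightarrow> real) \<Rightarrow> real" where
  "max_step p z d = (GREATEST \<alpha>. move z \<alpha> d \<in> prob_simplex p)"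

definition suff_decrease ::
  "((nat \<Rightarrow> real) \<Rightarrow> real) \<Rightarrow> real \<Rightarrow> (nat \<Rightarrow> real) \<Rightarrow> (nat \<Rightarrow> real) \<Rightarrow> real \<Rightarrow> bool" where
  "suff_decrease \<phi> \<gamma> z d \<alpha> \<longleftrightarrow> \<phi> (move z \<alpha> d) \<le> \<phi> z - \<gamma> * \<alpha>\<^sup>2"

text \<open>
  Big-step semantics of the extrapolation loop: \<open>expansion \<phi> \<gamma> \<delta> z d a \<alpha> \<beta> \<alpha>'\<close> says that the
  loop, entered with values \<open>\<alpha>\<close> and \<open>\<beta>\<close>, terminates with final value \<open>\<alpha>'\<close> of \<open>\<alpha>\<close>;
  \<open>a\<close> is the largest feasible step.
\<close>

inductive expansion ::
  "((nat \<Rightarrow> real) \<Rightarrow> real) \<Rightarrow> real \<Rightarrow> real \<Rightarrow> (nat \<Rightarrow> real) \<Rightarrow> (nat \<Rightarrow> real) \<Rightarrow> real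
    \<Rightarrow> real \<Rightarrow> real \<Rightarrow> real \<Rightarrow> bool"
  for \<phi> \<gamma> \<delta> z d a where
  stop: "\<not> (\<alpha> < a \<and> suff_decrease \<phi> \<gamma> z d \<beta>) \<Longrightarrow> expansion \<phi> \<gamma> \<delta> z d a \<alpha> \<beta> \<alpha>"
| loop: "\<alpha> < a \<Longrightarrow> suff_decrease \<phi> \<gamma> z d \<beta>
    \<Longrightarrow> expansion \<phi> \<gamma> \<delta> z d a \<beta> (min a (\<beta> / \<delta>)) \<alpha>'
    \<Longrightarrow> expansion \<phi> \<gamma> \<delta> z d a \<alpha> \<beta> \<alpha>'"

text \<open>The last two arguments are the returned step size and the returned direction.\<close>

definition line_search ::
  "((nat \<Rightarrow> real) \<Rightarrow> real) \<Rightarrow> nat \<Rightarrow> (nat \<Rightarrow> real) \<Rightarrow> (nat \<Rightarrow> real) \<Rightarrow> real \<Rightarrow> real \<Rightarrow> real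
    \<Rightarrow> real \<Rightarrow> (nat \<Rightarrow> real) \<Rightarrow> bool" where
  "line_search \<phi> p z d \<alpha>hat \<gamma> \<delta> \<alpha>' d' \<longleftrightarrow>
    (let a\<^sub>1 = max_step p z d;      \<alpha>\<^sub>1 = min a\<^sub>1 \<alpha>hat;
         a\<^sub>2 = max_step p z (- d);  \<alpha>\<^sub>2 = min a\<^sub>2 \<alpha>hat
     in if \<alpha>\<^sub>1 > 0 \<and> suff_decrease \<phi> \<gamma> z d \<alpha>\<^sub>1
          then expansion \<phi> \<gamma> \<delta> z d a\<^sub>1 \<alpha>\<^sub>1 (min a\<^sub>1 (\<alpha>\<^sub>1 / \<delta>)) \<alpha>' \<and> d' = d
        else if \<alpha>\<^sub>2 > 0 \<and> suff_decrease \<phi> \<gamma> z (- d) \<alpha>\<^sub>2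
          then expansion \<phi> \<gamma> \<delta> z (- d) a\<^sub>2 \<alpha>\<^sub>2 (min a\<^sub>2 (\<alpha>\<^sub>2 / \<delta>)) \<alpha>' \<and> d' = - d
        else \<alpha>' = 0 \<and> d' = d)"

section \<open>DF-SIMPLEX\<close>

text \<open>
  One iteration \<open>l\<close>. Coordinates are numbered from \<open>0\<close>, so that \<open>z l 0\<close> is the first and
  \<open>z l p\<close> the last inner point.
\<close>

definition df_simplex_iter ::
  "((nat \<Rightarrow> real) \<Rightarrow> real) \<Rightarrow> nat \<Rightarrow> real \<Rightarrow> real \<Rightarrow> real \<Rightarrow> real \<Rightarrow> real
    \<Rightarrow> (nat \<Rightarrow> nat \<Rightarrow> real) \<Rightarrow> (nat \<Rightarrow> nat \<Rightarrow> real) \<Rightarrow> (nat \<Rightarrow> nat) \<Rightarrow> (nat \<Rightarrow> nat \<Rightarrow> real)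
    \<Rightarrow> (nat \<Rightarrow> nat \<Rightarrow> nat \<Rightarrow> real) \<Rightarrow> (nat \<Rightarrow> nat \<Rightarrow> nat \<Rightarrow> real) \<Rightarrow> nat \<Rightarrow> bool" where
  "df_simplex_iter \<phi> p \<epsilon> \<tau> \<theta> \<gamma> \<delta> y \<alpha>hat j \<alpha> d z l \<longleftrightarrow>
    j l < p \<and> y l (j l) \<ge> \<tau> * Max {y l i | i. i < p} \<and>
    z l 0 = y l \<and>
    (\<forall>i<p. if i \<noteq> j l
       then line_search \<phi> p (z l i) (basis_vec i - basis_vec (j l)) (\<alpha>hat l i) \<gamma> \<delta> (\<alpha> l i) (d l i) \<and>
            \<alpha>hat (Suc l) i = (if \<alpha> l i = 0 then max (\<theta> * \<alpha>hat l i) \<epsilon> else \<alpha> l i)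
       else \<alpha> l i = 0 \<and> d l i = (\<lambda>h. 0)) \<and>
    (\<forall>i<p. z l (Suc i) = move (z l i) (\<alpha> l i) (d l i)) \<and>
    \<alpha>hat (Suc l) (j l) = Min ({\<alpha>hat (Suc l) i | i. i < p \<and> i \<noteq> j l} \<union> {\<alpha>hat l (j l)}) \<and>
    y (Suc l) = z l p"

definition df_simplex_stop ::
  "nat \<Rightarrow> real \<Rightarrow> (nat \<Rightarrow> nat \<Rightarrow> real) \<Rightarrow> (nat \<Rightarrow> nat) \<Rightarrow> (nat \<Rightarrow> nat \<Rightarrow> real) \<Rightarrow> nat \<Rightarrow> bool" where
  "df_simplex_stop p \<epsilon> \<alpha>hat j \<alpha> l \<longleftrightarrow>
    (\<forall>i<p. \<alpha>hat l i = \<epsilon>) \<and> (\<forall>i<p. i \<noteq> j l \<longrightarrow> \<alpha> l i = 0)"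

text \<open>
  Some run from \<open>y\<^sub>0\<close> with tolerance \<open>\<epsilon>\<close> stops and returns \<open>ybar\<close>. The choices of the indices
  \<open>j l\<close> and of the positive initial step sizes are left open.
\<close>

definition df_simplex ::
  "((nat \<Rightarrow> real) \<Rightarrow> real) \<Rightarrow> nat \<Rightarrow> real \<Rightarrow> real \<Rightarrow> real \<Rightarrow> real \<Rightarrow> real
    \<Rightarrow> (nat \<Rightarrow> real) \<Rightarrow> (nat \<Rightarrow> real) \<Rightarrow> bool" where
  "df_simplex \<phi> p \<epsilon> \<tau> \<theta> \<gamma> \<delta> y\<^sub>0 ybar \<longleftrightarrow>
    y\<^sub>0 \<in> prob_simplex p \<and>
    (\<exists>y \<alpha>hat j \<alpha> d z L.
       y 0 = y\<^sub>0 \<and> (\<forall>i<p. \<alpha>hat 0 i > 0) \<and>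
       (\<forall>l\<le>L. df_simplex_iter \<phi> p \<epsilon> \<tau> \<theta> \<gamma> \<delta> y \<alpha>hat j \<alpha> d z l) \<and>
       (\<forall>l<L. \<not> df_simplex_stop p \<epsilon> \<alpha>hat j \<alpha> l) \<and>
       df_simplex_stop p \<epsilon> \<alpha>hat j \<alpha> L \<and>
       ybar = y L)"

section \<open>Optimize, Refine and Drop\<close>

text \<open>
  The current set of atoms \<open>\<A>\<^sup>k\<close> is \<open>set (cols k)\<close>, and the columns of \<open>A\<^sup>k\<close> are listed, in an
  arbitrary order, by the distinct list \<open>cols k\<close>.
\<close>

definition obj :: "('a::real_vector \<Rightarrow> real) \<Rightarrow> 'a list \<Rightarrow> (nat \<Rightarrow> real) \<Rightarrow> real" where
  "obj f cs = (\<lambda>y. f (mat_vec cs y))"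

definition optimize_phase ::
  "('a::real_vector \<Rightarrow> real) \<Rightarrow> real \<Rightarrow> real \<Rightarrow> real \<Rightarrow> real \<Rightarrow> real
    \<Rightarrow> 'a list \<Rightarrow> (nat \<Rightarrow> real) \<Rightarrow> (nat \<Rightarrow> real) \<Rightarrow> 'a \<Rightarrow> bool" where
  "optimize_phase f \<epsilon> \<tau> \<theta> \<gamma> \<delta> cs y ybar xbar \<longleftrightarrow>
    (if length cs = 1 then ybar = y
     else df_simplex (obj f cs) (length cs) \<epsilon> \<tau> \<theta> \<gamma> \<delta> y ybar) \<and>
    xbar = mat_vec cs ybar"

definition refine_ok ::
  "('a::real_vector \<Rightarrow> real) \<Rightarrow> 'a set \<Rightarrow> real \<Rightarrow> 'a list \<Rightarrow> 'a \<Rightarrow> real \<Rightarrow> 'a \<Rightarrow> real \<Rightarrow> bool" where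
  "refine_ok f \<A> \<gamma> cs xbar \<mu>hat a \<mu> \<longleftrightarrow>
    a \<in> \<A> - set cs \<and> \<mu> \<in> {\<mu>hat..1} \<and> f (xbar + \<mu> *\<^sub>R (a - xbar)) \<le> f xbar - \<gamma> * \<mu>\<^sup>2"

definition refine_phase ::
  "('a::real_vector \<Rightarrow> real) \<Rightarrow> 'a set \<Rightarrow> real \<Rightarrow> real \<Rightarrow> 'a list \<Rightarrow> 'a \<Rightarrow> real
    \<Rightarrow> 'a \<Rightarrow> 'a set \<Rightarrow> real \<Rightarrow> bool" where
  "refine_phase f \<A> \<gamma> \<theta> cs xbar \<mu>hat x' R \<mu>hat' \<longleftrightarrow>
    (if \<exists>a \<mu>. refine_ok f \<A> \<gamma> cs xbar \<mu>hat a \<mu>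
     then \<exists>a \<mu>. refine_ok f \<A> \<gamma> cs xbar \<mu>hat a \<mu> \<and>
            x' = xbar + \<mu> *\<^sub>R (a - xbar) \<and> R = {a} \<and> \<mu>hat' = \<mu>hat
     else x' = xbar \<and> R = {} \<and> \<mu>hat' = \<theta> * \<mu>hat)"

definition drop_phase ::
  "'a::real_vector list \<Rightarrow> (nat \<Rightarrow> real) \<Rightarrow> 'a set \<Rightarrow> 'a set \<Rightarrow> 'a
    \<Rightarrow> 'a list \<Rightarrow> (nat \<Rightarrow> real) \<Rightarrow> bool" where
  "drop_phase cs ybar R D x' cs' y' \<longleftrightarrow>
    D \<subseteq> {a \<in> set cs. \<exists>h<length cs. a = mat_vec cs (basis_vec h) \<and> ybar h = 0} \<and>
    distinct cs' \<and> set cs' = (set cs \<union> R) - D \<and>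
    y' \<in> prob_simplex (length cs') \<and> x' = mat_vec cs' y'"

text \<open>
  The parameters \<open>\<tau>\<close>, \<open>\<theta>\<^sub>S\<close>, \<open>\<gamma>\<^sub>S\<close>, \<open>\<delta>\<close> belong to DF-SIMPLEX, while \<open>\<gamma>\<close>, \<open>\<theta>\<close> are those of the
  refine phase.
\<close>

locale ORD =
  fixes \<A> :: "'a::real_vector set" and f :: "'a \<Rightarrow> real"
    and \<tau> \<theta>\<^sub>S \<gamma>\<^sub>S \<delta> :: real and \<gamma> \<theta> :: real and \<epsilon> :: "nat \<Rightarrow> real"
    and cols :: "nat \<Rightarrow> 'a list" and x xbar :: "nat \<Rightarrow> 'a"
    and y ybar :: "nat \<Rightarrow> nat \<Rightarrow> real" and \<mu>hat :: "nat \<Rightarrow> real" and R D :: "nat \<Rightarrow> 'a set"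
  assumes df_simplex_params: "0 < \<tau>" "\<tau> \<le> 1" "0 < \<theta>\<^sub>S" "\<theta>\<^sub>S < 1" "0 < \<gamma>\<^sub>S" "0 < \<delta>" "\<delta> < 1"
    and ord_params: "0 < \<gamma>" "0 < \<theta>" "\<theta> < 1" "0 < \<mu>hat 0" "\<mu>hat 0 < 1"
    and tolerances: "\<And>k. 0 < \<epsilon> k" "decseq \<epsilon>" "\<epsilon> \<longlonglongrightarrow> 0"
    and initial_atoms: "distinct (cols 0)" "set (cols 0) \<subseteq> \<A>"
    and initial_point: "\<exists>i<length (cols 0). x 0 = cols 0 ! i \<and> y 0 = basis_vec i"
    and optimize: "\<And>k. optimize_phase f (\<epsilon> k) \<tau> \<theta>\<^sub>S \<gamma>\<^sub>S \<delta> (cols k) (y k) (ybar k) (xbar k)"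
    and refine: "\<And>k. refine_phase f \<A> \<gamma> \<theta> (cols k) (xbar k) (\<mu>hat k)
                         (x (Suc k)) (R k) (\<mu>hat (Suc k))"
    and drop: "\<And>k. drop_phase (cols k) (ybar k) (R k) (D k) (x (Suc k)) (cols (Suc k)) (y (Suc k))"

end

theory Submission
  imports Defs
begin

text \<open>
  The optimize phase does not increase \<open>f\<close>, and a successful refine step with step size \<open>\<mu>\<close>
  decreases it by at least \<open>\<gamma> \<mu>\<^sup>2\<close>. As \<open>f (x k)\<close> converges, these step sizes tend to \<open>0\<close>, so
  \<open>xbar k\<close> converges to the same limit \<open>x\<^sup>*\<close>. Let \<open>G\<close> be the gradient of \<open>f\<close> at \<open>x\<^sup>*\<close> and \<open>a\<close> an
  atom with \<open>G \<bullet> (a - x\<^sup>*) > 0\<close>. The stopping criterion of DF-SIMPLEX bounds \<open>G \<bullet> (c - xbar k)\<close>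
  above by a null sequence for every column \<open>c\<close> of positive weight, so for large \<open>k\<close> the
  weight of \<open>a\<close> is \<open>0\<close>; the approximate gradient then has the right sign and \<open>a\<close> is dropped.
  It is not added again, because close to \<open>x\<^sup>*\<close> small steps towards \<open>a\<close> increase \<open>f\<close>.
\<close>

text \<open>Mean value inequality for \<open>f\<close> minus the linear functional given by
  \<open>f' x\<^sub>0\<close>: the gradient of this difference has norm below \<open>\<eta>\<close>
  on a small ball. Both end points stay free because the estimate is later used at the moving points
  \<open>xbar k\<close>.\<close>

lemma C1_strict_derivative:
  fixes f :: "'a::real_inner \<Rightarrow> real"
  assumes deriv: "\<And>v. GDERIV f v :> f' v" and cont: "isCont f' x\<^sub>0" and "0 < \<eta>"
  obtains \<rho> where "0 < \<rho>"
    "\<And>u v. u \<in> ball x\<^sub>0 \<rho> \<Longrightarrow> v \<in> ball x\<^sub>0 \<rho> \<Longrightarrow> \<bar>f v - f u - f' x\<^sub>0 \<bullet> (v - u)\<bar> \<le> \<eta> * norm (v - u)"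
proof -
  from cont \<open>0 < \<eta>\<close> have "\<exists>\<rho>>0. \<forall>v. dist v x\<^sub>0 < \<rho> \<longrightarrow> dist (f' v) (f' x\<^sub>0) < \<eta>"
    by (simp add: continuous_at_eps_delta)
  then obtain \<rho> where "\<rho> > 0" and \<rho>: "\<forall>v. dist v x\<^sub>0 < \<rho> \<longrightarrow> dist (f' v) (f' x\<^sub>0) < \<eta>"
    by blast
  have "\<bar>f v - f u - f' x\<^sub>0 \<bullet> (v - u)\<bar> \<le> \<eta> * norm (v - u)"
    if "u \<in> ball x\<^sub>0 \<rho>" "v \<in> ball x\<^sub>0 \<rho>" for u v
  proof -
    have "norm ((f v - f' x\<^sub>0 \<bullet> v) - (f u - f' x\<^sub>0 \<bullet> u)) \<le> \<eta> * norm (v - u)"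
    proof (rule differentiable_bound[OF convex_ball])
      fix w assume w: "w \<in> ball x\<^sub>0 \<rho>"
      show "((\<lambda>v. f v - f' x\<^sub>0 \<bullet> v) has_derivative (\<lambda>h. (f' w - f' x\<^sub>0) \<bullet> h)) (at w within ball x\<^sub>0 \<rho>)"
        using has_derivative_at_withinI[OF deriv[of w, unfolded gderiv_def]]
        by (rule has_derivative_eq_rhs[OF has_derivative_diff])
          (auto intro!: derivative_eq_intros simp: inner_diff_left inner_diff_right inner_commute)
      show "onorm (\<lambda>h. (f' w - f' x\<^sub>0) \<bullet> h) \<le> \<eta>"
      proof (rule onorm_bound)
        show "norm ((f' w - f' x\<^sub>0) \<bullet> h) \<le> \<eta> * norm h" for h
        proof -
          have "norm ((f' w - f' x\<^sub>0) \<bullet> h) \<le> norm (f' w - f' x\<^sub>0) * norm h"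
            using Cauchy_Schwarz_ineq2 by simp
          also have "\<dots> \<le> \<eta> * norm h"
            using \<rho>[rule_format, of w] w
            by (intro mult_right_mono) (auto simp: dist_commute dist_norm[symmetric])
          finally show ?thesis .
        qed
      qed (use \<open>0 < \<eta>\<close> in simp)
    qed (use that in auto)
    then show ?thesis
      by (simp add: inner_diff_right algebra_simps)
  qed
  with \<open>\<rho> > 0\<close> show thesis using that by blast
qed

subsection \<open>The simplex and its edge directions\<close>

lemma prob_simplexD:
  assumes "w \<in> prob_simplex p"
  shows "(\<Sum>i<p. w i) = 1" "0 \<le> w i" "i \<ge> p \<Longrightarrow> w i = 0"
  using assms by (cases "i < p"; simp add: prob_simplex_def)+

lemma sum_basis_vec:
  fixes c :: "nat \<Rightarrow> 'a::real_vector"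
  assumes "i < p"
  shows "(\<Sum>h<p. basis_vec i h *\<^sub>R c h) = c i"
  using assms by (simp add: basis_vec_def if_distrib[of "\<lambda>t. t *\<^sub>R _"] sum.delta cong: if_cong)

lemma basis_vec_in_prob_simplex: "i < p \<Longrightarrow> basis_vec i \<in> prob_simplex p"
  by (auto simp: prob_simplex_def basis_vec_def)

lemma mat_vec_basis_vec: "i < length cs \<Longrightarrow> mat_vec cs (basis_vec i) = cs ! i"
  by (simp add: mat_vec_def sum_basis_vec)

lemma mat_vec_move: "mat_vec cs (move z t d) = mat_vec cs z + t *\<^sub>R mat_vec cs d"
  by (simp add: mat_vec_def move_def scaleR_left_distrib sum.distrib scaleR_sum_right)

lemma mat_vec_diff: "mat_vec cs (u - v) = mat_vec cs u - mat_vec cs v"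
  by (simp add: mat_vec_def scaleR_left_diff_distrib sum_subtractf)

text \<open>Only the coordinates \<open>i\<close> and \<open>j\<close> change, and the total mass is
  preserved, so what remains is the sign of these two. Exchanging \<open>i\<close> and
  \<open>j\<close> covers the opposite search direction.\<close>

lemma move_edge_in_prob_simplex_iff:
  assumes z: "z \<in> prob_simplex p" and ij: "i < p" "j < p" "i \<noteq> j"
  shows "move z t (basis_vec i - basis_vec j) \<in> prob_simplex p \<longleftrightarrow> - z i \<le> t \<and> t \<le> z j"
proof -
  let ?w = "move z t (basis_vec i - basis_vec j)"
  have w: "?w h = (if h = i then z i + t else if h = j then z j - t else z h)" for h
    using ij by (auto simp: move_def basis_vec_def)
  have basis: "(\<Sum>h<p. basis_vec k h) = (1::real)" if "k < p" for k
    using prob_simplexD(1)[OF basis_vec_in_prob_simplex[OF that]] .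
  have "(\<Sum>h<p. ?w h) = 1"
    using prob_simplexD(1)[OF z] ij
    by (simp add: move_def sum.distrib sum_subtractf basis flip: sum_distrib_left)
  then show ?thesis
    using ij prob_simplexD(2,3)[OF z] by (auto simp: prob_simplex_def w split: if_splits)
qed

lemma max_step_edge:
  assumes z: "z \<in> prob_simplex p" and "i < p" "j < p" "i \<noteq> j"
  shows "max_step p z (basis_vec i - basis_vec j) = z j"
  unfolding max_step_def move_edge_in_prob_simplex_iff[OF assms]
  using prob_simplexD(2)[OF z, of i] prob_simplexD(2)[OF z, of j]
  by (intro Greatest_equality) auto

subsection \<open>Line search and DF-SIMPLEX\<close>

text \<open>Loop invariant: every value taken by \<open>\<alpha>\<close> has passed the decrease
  test, and the next trial \<open>min a (\<beta> / \<delta>)\<close> is again positive and at most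
  \<open>a\<close>.\<close>

lemma expansion_step:
  assumes "expansion \<phi> \<gamma> \<delta> z d a \<alpha> \<beta> \<alpha>'"
    and "0 < \<delta>" "0 < \<alpha>" "\<alpha> \<le> a" "0 < \<beta>" "\<beta> \<le> a" "suff_decrease \<phi> \<gamma> z d \<alpha>"
  shows "0 < \<alpha>' \<and> \<alpha>' \<le> a \<and> suff_decrease \<phi> \<gamma> z d \<alpha>'"
  using assms by (induction rule: expansion.induct) auto

lemma suff_decreaseD: "suff_decrease \<phi> \<gamma> z d \<alpha> \<Longrightarrow> 0 \<le> \<gamma> \<Longrightarrow> \<phi> (move z \<alpha> d) \<le> \<phi> z"
  unfolding suff_decrease_def by (smt (verit) mult_nonneg_nonneg zero_le_power2)

text \<open>A successful search returns a positive step, so a zero step means that both initial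
  trials were rejected. With \<open>\<alpha>hat\<close> and the weight positive the trial step is
  positive, hence the rejection comes from the decrease test.\<close>

lemma line_search_edge:
  assumes ls: "line_search \<phi> p z (basis_vec i - basis_vec j) \<alpha>hat \<gamma> \<delta> \<alpha>' d'"
    and z: "z \<in> prob_simplex p" and ij: "i < p" "j < p" "i \<noteq> j" and "0 < \<delta>" "0 \<le> \<gamma>"
  shows "move z \<alpha>' d' \<in> prob_simplex p" (is ?feasible)
    and "\<phi> (move z \<alpha>' d') \<le> \<phi> z" (is ?decrease)
    and "\<alpha>' = 0 \<Longrightarrow> 0 < \<alpha>hat \<Longrightarrow> 0 < z j \<Longrightarrow>
      \<not> suff_decrease \<phi> \<gamma> z (basis_vec i - basis_vec j) (min (z j) \<alpha>hat)" (is "_ \<Longrightarrow> _ \<Longrightarrow> _ \<Longrightarrow> ?fwd")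
    and "\<alpha>' = 0 \<Longrightarrow> 0 < \<alpha>hat \<Longrightarrow> 0 < z i \<Longrightarrow>
      \<not> suff_decrease \<phi> \<gamma> z (basis_vec j - basis_vec i) (min (z i) \<alpha>hat)" (is "_ \<Longrightarrow> _ \<Longrightarrow> _ \<Longrightarrow> ?bwd")
proof -
  let ?d = "basis_vec i - basis_vec j" and ?d' = "basis_vec j - basis_vec i"
  have neg: "- ?d = ?d'" by (simp add: fun_eq_iff)
  note nonneg = prob_simplexD(2)[OF z]
  have m: "max_step p z ?d = z j" "max_step p z ?d' = z i"
    using max_step_edge[OF z] ij by auto
  consider
      (fwd) "0 < min (z j) \<alpha>hat" "suff_decrease \<phi> \<gamma> z ?d (min (z j) \<alpha>hat)"
        "expansion \<phi> \<gamma> \<delta> z ?d (z j) (min (z j) \<alpha>hat) (min (z j) (min (z j) \<alpha>hat / \<delta>)) \<alpha>'" "d' = ?d"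
    | (bwd) "0 < min (z i) \<alpha>hat" "suff_decrease \<phi> \<gamma> z ?d' (min (z i) \<alpha>hat)"
        "expansion \<phi> \<gamma> \<delta> z ?d' (z i) (min (z i) \<alpha>hat) (min (z i) (min (z i) \<alpha>hat / \<delta>)) \<alpha>'" "d' = ?d'"
    | (none) "\<not> (0 < min (z j) \<alpha>hat \<and> suff_decrease \<phi> \<gamma> z ?d (min (z j) \<alpha>hat))"
        "\<not> (0 < min (z i) \<alpha>hat \<and> suff_decrease \<phi> \<gamma> z ?d' (min (z i) \<alpha>hat))" "\<alpha>' = 0"
    using ls unfolding line_search_def Let_def neg m by (auto split: if_splits)
  then have "?feasible \<and> ?decrease \<and> (\<alpha>' = 0 \<longrightarrow> 0 < \<alpha>hat \<longrightarrow> (0 < z j \<longrightarrow> ?fwd) \<and> (0 < z i \<longrightarrow> ?bwd))"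
  proof cases
    case fwd
    have "0 < \<alpha>' \<and> \<alpha>' \<le> z j \<and> suff_decrease \<phi> \<gamma> z ?d \<alpha>'"
      using fwd(1,2) \<open>0 < \<delta>\<close> by (intro expansion_step[OF fwd(3)]) auto
    then show ?thesis
      using move_edge_in_prob_simplex_iff[OF z ij] nonneg[of i] suff_decreaseD[OF _ \<open>0 \<le> \<gamma>\<close>] fwd(4)
      by fastforce
  next
    case bwd
    have "0 < \<alpha>' \<and> \<alpha>' \<le> z i \<and> suff_decrease \<phi> \<gamma> z ?d' \<alpha>'"
      using bwd(1,2) \<open>0 < \<delta>\<close> by (intro expansion_step[OF bwd(3)]) auto
    then show ?thesis
      using move_edge_in_prob_simplex_iff[OF z ij(2,1)] ij nonneg[of j]
        suff_decreaseD[OF _ \<open>0 \<le> \<gamma>\<close>] bwd(4)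
      by fastforce
  next
    case none
    then show ?thesis using z by (auto simp: move_def)
  qed
  then show ?feasible ?decrease
    and "\<alpha>' = 0 \<Longrightarrow> 0 < \<alpha>hat \<Longrightarrow> 0 < z j \<Longrightarrow> ?fwd"
    and "\<alpha>' = 0 \<Longrightarrow> 0 < \<alpha>hat \<Longrightarrow> 0 < z i \<Longrightarrow> ?bwd"
    by blast+
qed

lemma df_simplex_iter_inner:
  assumes iter: "df_simplex_iter \<phi> p \<epsilon> \<tau> \<theta> \<gamma> \<delta> y \<alpha>hat j \<alpha> d z l"
    and y: "y l \<in> prob_simplex p" and "0 < \<delta>" "0 \<le> \<gamma>" and "i \<le> p"
  shows "z l i \<in> prob_simplex p \<and> \<phi> (z l i) \<le> \<phi> (y l)"
  using \<open>i \<le> p\<close>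
proof (induction i)
  case 0
  then show ?case using iter y by (simp add: df_simplex_iter_def)
next
  case (Suc i)
  have IH: "z l i \<in> prob_simplex p" "\<phi> (z l i) \<le> \<phi> (y l)" and "i < p" using Suc by auto
  have z: "z l (Suc i) = move (z l i) (\<alpha> l i) (d l i)" and j: "j l < p"
    using iter \<open>i < p\<close> by (auto simp: df_simplex_iter_def)
  show ?case
  proof (cases "i = j l")
    case True
    then have "z l (Suc i) = z l i"
      using iter \<open>i < p\<close> z by (auto simp: df_simplex_iter_def move_def)
    then show ?thesis using IH by simp
  next
    case False
    have "line_search \<phi> p (z l i) (basis_vec i - basis_vec (j l)) (\<alpha>hat l i) \<gamma> \<delta> (\<alpha> l i) (d l i)"
      using iter \<open>i < p\<close> False by (auto simp: df_simplex_iter_def)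
    from line_search_edge(1,2)[OF this IH(1) \<open>i < p\<close> j False \<open>0 < \<delta>\<close> \<open>0 \<le> \<gamma>\<close>]
    show ?thesis using z IH(2) by auto
  qed
qed

text \<open>At the stopping iteration nothing moves, so all rejected trials start from the same
  point \<open>ybar\<close> with the same initial step \<open>\<epsilon>\<close>. The index
  \<open>j\<close> is the pivot of that iteration.\<close>

lemma df_simplex_result:
  assumes dfs: "df_simplex \<phi> p \<epsilon> \<tau> \<theta> \<gamma> \<delta> y\<^sub>0 ybar"
    and "0 < \<epsilon>" "0 < \<tau>" "0 < \<delta>" "0 \<le> \<gamma>"
  shows "ybar \<in> prob_simplex p" and "\<phi> ybar \<le> \<phi> y\<^sub>0"
    and "\<exists>j<p. \<tau> / p \<le> ybar j \<and>
      (\<forall>i<p. i \<noteq> j \<longrightarrow>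
        \<not> suff_decrease \<phi> \<gamma> ybar (basis_vec i - basis_vec j) (min (ybar j) \<epsilon>) \<and>
        (0 < ybar i \<longrightarrow> \<not> suff_decrease \<phi> \<gamma> ybar (basis_vec j - basis_vec i) (min (ybar i) \<epsilon>)))"
proof -
  obtain y \<alpha>hat j \<alpha> d z L where y0: "y 0 = y\<^sub>0" "y\<^sub>0 \<in> prob_simplex p"
    and iter: "\<And>l. l \<le> L \<Longrightarrow> df_simplex_iter \<phi> p \<epsilon> \<tau> \<theta> \<gamma> \<delta> y \<alpha>hat j \<alpha> d z l"
    and stop: "df_simplex_stop p \<epsilon> \<alpha>hat j \<alpha> L" and ybar: "ybar = y L"
    using dfs unfolding df_simplex_def by blast
  have inv: "y l \<in> prob_simplex p \<and> \<phi> (y l) \<le> \<phi> y\<^sub>0" if "l \<le> L" for l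
    using that
  proof (induction l)
    case (Suc l)
    then have IH: "y l \<in> prob_simplex p" "\<phi> (y l) \<le> \<phi> y\<^sub>0" by auto
    have "y (Suc l) = z l p" using iter[of l] Suc.prems by (simp add: df_simplex_iter_def)
    then show ?case
      using df_simplex_iter_inner[OF iter IH(1) \<open>0 < \<delta>\<close> \<open>0 \<le> \<gamma>\<close>, of p] IH(2) Suc.prems by auto
  qed (use y0 in auto)
  then show ybar_simplex: "ybar \<in> prob_simplex p" and "\<phi> ybar \<le> \<phi> y\<^sub>0" using ybar by auto
  define J where "J = j L"
  have J: "J < p" and Max: "\<tau> * Max {ybar i | i. i < p} \<le> ybar J"
    using iter[of L] by (auto simp: df_simplex_iter_def J_def ybar)
  \<comment> \<open>The largest weight is at least the average \<open>1 / p\<close>; the pivot rule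
    turns this into a lower bound for the pivot weight.\<close>
  have "1 = (\<Sum>i<p. ybar i)" using prob_simplexD(1)[OF ybar_simplex] by simp
  also have "\<dots> \<le> (\<Sum>i<p. Max {ybar i | i. i < p})"
    by (intro sum_mono Max_ge) auto
  also have "\<dots> = real p * Max {ybar i | i. i < p}"
    by simp
  finally have "\<tau> / p \<le> \<tau> * Max {ybar i | i. i < p}"
    using J \<open>0 < \<tau>\<close> by (simp add: field_simps)
  with Max have lower: "\<tau> / p \<le> ybar J" by linarith
  have "0 < \<tau> / p" using J \<open>0 < \<tau>\<close> by simp
  with lower have "0 < ybar J" by linarith
  \<comment> \<open>At the pivot the step is zero by definition of the iteration, elsewhere by the
    stopping test.\<close>
  have stopped: "\<alpha> L i = 0" if "i < p" for i
    using that stop iter[of L] by (cases "i = J") (auto simp: df_simplex_stop_def df_simplex_iter_def J_def)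
  have z: "z L i = ybar" if "i \<le> p" for i
    using that
  proof (induction i)
    case (Suc i)
    have "z L (Suc i) = move (z L i) (\<alpha> L i) (d L i)"
      using iter[of L] Suc.prems by (auto simp: df_simplex_iter_def)
    then show ?case using Suc stopped[of i] by (simp add: move_def)
  qed (use iter[of L] ybar in \<open>auto simp: df_simplex_iter_def\<close>)
  have "\<not> suff_decrease \<phi> \<gamma> ybar (basis_vec i - basis_vec J) (min (ybar J) \<epsilon>) \<and>
        (0 < ybar i \<longrightarrow> \<not> suff_decrease \<phi> \<gamma> ybar (basis_vec J - basis_vec i) (min (ybar i) \<epsilon>))"
    if "i < p" "i \<noteq> J" for i
  proof -
    have "\<alpha>hat L i = \<epsilon>" using stop that by (auto simp: df_simplex_stop_def)
    moreover have "line_search \<phi> p (z L i) (basis_vec i - basis_vec J) (\<alpha>hat L i) \<gamma> \<delta> (\<alpha> L i) (d L i)"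
      using iter[of L] that by (auto simp: df_simplex_iter_def J_def)
    ultimately have "line_search \<phi> p ybar (basis_vec i - basis_vec J) \<epsilon> \<gamma> \<delta> 0 (d L i)"
      using z[of i] stopped that by auto
    from line_search_edge(3,4)[OF this ybar_simplex that(1) J that(2) \<open>0 < \<delta>\<close> \<open>0 \<le> \<gamma>\<close>]
    show ?thesis using \<open>0 < ybar J\<close> \<open>0 < \<epsilon>\<close> by auto
  qed
  then show "\<exists>j<p. \<tau> / p \<le> ybar j \<and>
      (\<forall>i<p. i \<noteq> j \<longrightarrow>
        \<not> suff_decrease \<phi> \<gamma> ybar (basis_vec i - basis_vec j) (min (ybar j) \<epsilon>) \<and>
        (0 < ybar i \<longrightarrow> \<not> suff_decrease \<phi> \<gamma> ybar (basis_vec j - basis_vec i) (min (ybar i) \<epsilon>)))"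
    using J lower by blast
qed

subsection \<open>Approximate stationarity of the optimize phase\<close>

lemma inner_mat_vec_diff:
  fixes G :: "'a::real_inner"
  assumes "w \<in> prob_simplex (length cs)"
  shows "G \<bullet> (mat_vec cs w - c) = (\<Sum>i<length cs. w i * (G \<bullet> (cs ! i - c)))"
proof -
  have "mat_vec cs w - c = (\<Sum>i<length cs. w i *\<^sub>R (cs ! i - c))"
    using prob_simplexD(1)[OF assms]
    by (simp add: mat_vec_def scaleR_diff_right sum_subtractf flip: scaleR_sum_left)
  then show ?thesis by (simp add: inner_sum_right)
qed

lemma norm_mat_vec_le:
  fixes cs :: "'a::real_normed_vector list"
  assumes w: "w \<in> prob_simplex (length cs)" and B: "\<And>a. a \<in> set cs \<Longrightarrow> norm a \<le> B"
  shows "norm (mat_vec cs w) \<le> B"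
proof -
  have "norm (mat_vec cs w) \<le> (\<Sum>i<length cs. w i * B)"
    unfolding mat_vec_def
    by (rule sum_norm_le) (auto intro!: mult_mono B simp: prob_simplexD(2)[OF w])
  also have "\<dots> = B"
    using prob_simplexD(1)[OF w] by (simp flip: sum_distrib_right)
  finally show ?thesis .
qed

text \<open>The rejected test bounds the increment of \<open>f\<close> from below by
  \<open>- \<gamma> * t\<^sup>2\<close>, the linear model bounds it from above by
  \<open>t * (G \<bullet> e) + \<eta> * t * norm e\<close>; dividing by \<open>t\<close> gives the
  claim. Only \<open>t \<le> \<epsilon>\<close> enters the bound, so arbitrarily small trial steps
  are harmless.\<close>

lemma no_decrease_slope:
  fixes f :: "'a::real_inner \<Rightarrow> real"
  assumes strict: "\<And>u v. u \<in> ball x\<^sub>0 \<rho> \<Longrightarrow> v \<in> ball x\<^sub>0 \<rho> \<Longrightarrow>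
      \<bar>f v - f u - G \<bullet> (v - u)\<bar> \<le> \<eta> * norm (v - u)"
    and fail: "f u - \<gamma> * t\<^sup>2 \<le> f (u + t *\<^sub>R e)"
    and "norm e \<le> C" "0 < t" "t \<le> \<epsilon>" "0 \<le> \<gamma>" "0 \<le> \<eta>" and near: "dist x\<^sub>0 u + C * \<epsilon> < \<rho>"
  shows "- (\<gamma> * \<epsilon> + \<eta> * C) \<le> G \<bullet> e"
proof -
  have "0 \<le> C" using \<open>norm e \<le> C\<close> norm_ge_zero order_trans by blast
  have te: "t * norm e \<le> C * \<epsilon>"
    using assms \<open>0 \<le> C\<close> by (subst mult.commute, intro mult_mono) auto
  have u: "u \<in> ball x\<^sub>0 \<rho>"
    using near te mult_nonneg_nonneg[OF less_imp_le[OF \<open>0 < t\<close>] norm_ge_zero[of e]]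
    unfolding mem_ball by linarith
  have "dist x\<^sub>0 (u + t *\<^sub>R e) \<le> dist x\<^sub>0 u + t * norm e"
    using dist_triangle[of x\<^sub>0 "u + t *\<^sub>R e" u] \<open>0 < t\<close> by (simp add: dist_norm)
  then have "u + t *\<^sub>R e \<in> ball x\<^sub>0 \<rho>" using near te by simp
  from strict[OF u this] have "f (u + t *\<^sub>R e) - f u - t * (G \<bullet> e) \<le> \<eta> * (t * norm e)"
    using \<open>0 < t\<close> by simp
  with fail have "t * (- (\<gamma> * t) - \<eta> * norm e) \<le> t * (G \<bullet> e)"
    by (simp add: algebra_simps power2_eq_square)
  then have "- (\<gamma> * t) - \<eta> * norm e \<le> G \<bullet> e" using \<open>0 < t\<close> by simp
  moreover have "\<gamma> * t \<le> \<gamma> * \<epsilon>" "\<eta> * norm e \<le> \<eta> * C"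
    using assms by (auto intro: mult_left_mono)
  ultimately show ?thesis by linarith
qed

text \<open>
  Since the weight of the pivot \<open>j\<close> exceeds \<open>\<epsilon>\<close>, the failed searches towards the other vertices use
  the full step \<open>\<epsilon>\<close>, so \<open>G\<close> is nearly minimal at the pivot. The failed searches away from
  the vertices of positive weight, whose steps are at most \<open>\<epsilon>\<close> however small this weight is, show
  that \<open>G\<close> is nearly minimal there as well.
\<close>

lemma df_simplex_support_slope:
  fixes f :: "'a::real_inner \<Rightarrow> real"
  assumes dfs: "df_simplex (obj f cs) (length cs) \<epsilon> \<tau> \<theta> \<gamma> \<delta> y ybar"
    and params: "0 < \<epsilon>" "0 < \<tau>" "0 < \<delta>" "0 \<le> \<gamma>" "0 \<le> \<eta>" and \<epsilon>: "\<epsilon> \<le> \<tau> / length cs"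
    and B: "\<And>a. a \<in> set cs \<Longrightarrow> norm a \<le> B"
    and strict: "\<And>u v. u \<in> ball x\<^sub>0 \<rho> \<Longrightarrow> v \<in> ball x\<^sub>0 \<rho> \<Longrightarrow>
      \<bar>f v - f u - G \<bullet> (v - u)\<bar> \<le> \<eta> * norm (v - u)"
    and near: "dist x\<^sub>0 (mat_vec cs ybar) + 2 * B * \<epsilon> < \<rho>"
    and i: "i < length cs" "0 < ybar i"
  shows "G \<bullet> (cs ! i - mat_vec cs ybar) \<le> 2 * (\<gamma> * \<epsilon> + \<eta> * (2 * B))"
proof -
  let ?\<kappa> = "\<gamma> * \<epsilon> + \<eta> * (2 * B)"
  have ybar: "ybar \<in> prob_simplex (length cs)" by (rule df_simplex_result(1)[OF dfs params(1-4)])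
  have "0 \<le> B" using B[OF nth_mem[OF i(1)]] norm_ge_zero order_trans by blast
  then have "0 \<le> ?\<kappa>" using params by simp
  obtain j where j: "j < length cs" "\<tau> / length cs \<le> ybar j"
    and fail: "\<And>i. i < length cs \<Longrightarrow> i \<noteq> j \<Longrightarrow>
      \<not> suff_decrease (obj f cs) \<gamma> ybar (basis_vec i - basis_vec j) (min (ybar j) \<epsilon>)"
      "\<And>i. i < length cs \<Longrightarrow> i \<noteq> j \<Longrightarrow> 0 < ybar i \<Longrightarrow>
      \<not> suff_decrease (obj f cs) \<gamma> ybar (basis_vec j - basis_vec i) (min (ybar i) \<epsilon>)"
    using df_simplex_result(3)[OF dfs params(1-4)] by blast
  \<comment> \<open>A trial along \<open>basis_vec a - basis_vec b\<close> for the lifted objective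
    is a trial for \<open>f\<close> along \<open>cs ! a - cs ! b\<close>.\<close>
  have slope: "- ?\<kappa> \<le> G \<bullet> (cs ! a - cs ! b)"
    if "a < length cs" "b < length cs" "0 < t" "t \<le> \<epsilon>"
      "\<not> suff_decrease (obj f cs) \<gamma> ybar (basis_vec a - basis_vec b) t" for a b t
  proof (rule no_decrease_slope[OF strict])
    show "f (mat_vec cs ybar) - \<gamma> * t\<^sup>2 \<le> f (mat_vec cs ybar + t *\<^sub>R (cs ! a - cs ! b))"
      using that(1,2,5) by (simp add: suff_decrease_def obj_def mat_vec_move mat_vec_diff mat_vec_basis_vec)
    show "norm (cs ! a - cs ! b) \<le> 2 * B"
      using norm_triangle_ineq4[of "cs ! a" "cs ! b"] B[of "cs ! a"] B[of "cs ! b"] that(1,2) by simp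
  qed (use that params near in auto)
  have lower: "- ?\<kappa> \<le> G \<bullet> (cs ! h - cs ! j)" if "h < length cs" for h
  proof (cases "h = j")
    case False
    show ?thesis
      by (rule slope[of _ _ "min (ybar j) \<epsilon>"]) (use that j \<epsilon> params fail(1)[OF that False] in auto)
  qed (use \<open>0 \<le> ?\<kappa>\<close> in simp)
  have "G \<bullet> (cs ! i - cs ! j) \<le> ?\<kappa>"
  proof (cases "i = j")
    case False
    have "- ?\<kappa> \<le> G \<bullet> (cs ! j - cs ! i)"
      by (rule slope[of _ _ "min (ybar i) \<epsilon>"]) (use i j params fail(2)[OF i(1) False i(2)] in auto)
    then show ?thesis by (simp add: inner_diff_right)
  qed (use \<open>0 \<le> ?\<kappa>\<close> in simp)
  \<comment> \<open>Averaging \<open>lower\<close> with the weights \<open>ybar h\<close> passes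
    from the columns to their convex combination. Subtracting this from the upper bound at column
    \<open>i\<close> cancels the pivot and produces the factor 2.\<close>
  moreover have "- ?\<kappa> \<le> G \<bullet> (mat_vec cs ybar - cs ! j)"
  proof -
    have "- ?\<kappa> = (\<Sum>h<length cs. ybar h * (- ?\<kappa>))"
      using prob_simplexD(1)[OF ybar] by (simp flip: sum_distrib_right)
    also have "\<dots> \<le> (\<Sum>h<length cs. ybar h * (G \<bullet> (cs ! h - cs ! j)))"
      by (intro sum_mono mult_left_mono lower prob_simplexD(2)[OF ybar]) auto
    finally show ?thesis by (simp add: inner_mat_vec_diff[OF ybar])
  qed
  ultimately show ?thesis by (simp add: inner_diff_right)
qed

text \<open>Chain rule: changing coordinate \<open>h\<close> moves the image point along the line
  through it in direction \<open>cs ! h\<close>.\<close>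

lemma grad_obj:
  assumes deriv: "\<And>v. GDERIV f v :> f' v" and h: "h < length cs"
  shows "grad (obj f cs) y h = f' (mat_vec cs y) \<bullet> (cs ! h)"
proof -
  have upd: "mat_vec cs (y(h := t)) = mat_vec cs y + (t - y h) *\<^sub>R (cs ! h)" for t
  proof -
    have "y(h := t) = move y (t - y h) (basis_vec h)" by (auto simp: move_def basis_vec_def)
    then show ?thesis using h by (simp add: mat_vec_move mat_vec_basis_vec)
  qed
  have "((\<lambda>t. mat_vec cs y + (t - y h) *\<^sub>R (cs ! h)) has_derivative (\<lambda>s. s *\<^sub>R (cs ! h))) (at (y h))"
    by (auto intro!: derivative_eq_intros)
  moreover have "(f has_derivative (\<lambda>s. s \<bullet> f' (mat_vec cs y)))
      (at (mat_vec cs y + (y h - y h) *\<^sub>R (cs ! h)))"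
    using deriv[of "mat_vec cs y"] by (simp add: gderiv_def)
  ultimately have "((\<lambda>t. f (mat_vec cs y + (t - y h) *\<^sub>R (cs ! h))) has_derivative
      (\<lambda>s. (s *\<^sub>R (cs ! h)) \<bullet> f' (mat_vec cs y))) (at (y h))"
    by (rule has_derivative_compose)
  then have "((\<lambda>t. f (mat_vec cs y + (t - y h) *\<^sub>R (cs ! h))) has_field_derivative
      f' (mat_vec cs y) \<bullet> (cs ! h)) (at (y h))"
    by (simp add: has_field_derivative_def inner_commute mult_commute_abs)
  then show ?thesis
    unfolding grad_def obj_def upd by (rule DERIV_imp_deriv)
qed

text \<open>With the exact gradient the sum is the slope of \<open>f\<close> towards the column. The
  error pairs a vector with entries at most \<open>r\<close> in modulus with a difference of two
  probability vectors, whose l1 norm is at most 2; this gives a constant independent of the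
  dimension.\<close>

lemma approx_gradient_slope:
  assumes deriv: "\<And>v. GDERIV f v :> f' v" and w: "w \<in> prob_simplex (length cs)"
    and h: "h < length cs"
    and approx: "L2_set (\<lambda>i. grad (obj f cs) w i - g i) {..<length cs} \<le> r"
  shows "f' (mat_vec cs w) \<bullet> (cs ! h - mat_vec cs w) - 2 * r
    \<le> (\<Sum>i<length cs. g i * (basis_vec h i - w i))"
proof -
  let ?G = "f' (mat_vec cs w)" and ?e = "\<lambda>i. basis_vec h i - w i"
  have "0 \<le> r" using approx L2_set_nonneg order_trans by blast
  have "mat_vec cs (basis_vec h) - mat_vec cs w = (\<Sum>i<length cs. ?e i *\<^sub>R (cs ! i))"
    by (simp add: mat_vec_def scaleR_left_diff_distrib sum_subtractf)
  then have exact: "?G \<bullet> (cs ! h - mat_vec cs w) = (\<Sum>i<length cs. grad (obj f cs) w i * ?e i)"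
    using h by (simp add: mat_vec_basis_vec inner_sum_right grad_obj[OF deriv] mult.commute)
  have "?G \<bullet> (cs ! h - mat_vec cs w) - (\<Sum>i<length cs. g i * ?e i)
      = (\<Sum>i<length cs. (grad (obj f cs) w i - g i) * ?e i)"
    by (simp add: exact left_diff_distrib sum_subtractf)
  also have "\<dots> \<le> (\<Sum>i<length cs. r * (basis_vec h i + w i))"
  proof (rule sum_mono)
    fix i assume "i \<in> {..<length cs}"
    then have "\<bar>grad (obj f cs) w i - g i\<bar> \<le> r"
      using approx member_le_L2_set[of "{..<length cs}" i "\<lambda>i. \<bar>grad (obj f cs) w i - g i\<bar>"]
      by (simp add: L2_set_def)
    moreover have "\<bar>?e i\<bar> \<le> basis_vec h i + w i"
      using prob_simplexD(2)[OF w, of i] by (cases "i = h") (auto simp: basis_vec_def)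
    ultimately have "\<bar>grad (obj f cs) w i - g i\<bar> * \<bar>?e i\<bar> \<le> r * (basis_vec h i + w i)"
      using \<open>0 \<le> r\<close> by (intro mult_mono) auto
    then show "(grad (obj f cs) w i - g i) * ?e i \<le> r * (basis_vec h i + w i)"
      by (metis abs_ge_self abs_mult order_trans)
  qed
  also have "\<dots> = 2 * r"
    using prob_simplexD(1)[OF w] prob_simplexD(1)[OF basis_vec_in_prob_simplex[OF h]]
    by (simp add: sum.distrib flip: sum_distrib_left)
  finally show ?thesis by simp
qed

subsection \<open>Invariants of ORD\<close>

context ORD
begin

lemma invariant:
  "distinct (cols k) \<and> set (cols k) \<subseteq> \<A> \<and> y k \<in> prob_simplex (length (cols k)) \<and>
    x k = mat_vec (cols k) (y k) \<and> 0 < \<mu>hat k"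
proof (induction k)
  case 0
  then show ?case
    using initial_atoms initial_point ord_params
    by (auto simp: mat_vec_basis_vec basis_vec_in_prob_simplex)
next
  case (Suc k)
  have "R k \<subseteq> \<A>" "0 < \<mu>hat (Suc k)"
    using refine[of k] Suc ord_params by (auto simp: refine_phase_def refine_ok_def split: if_splits)
  then show ?case using drop[of k] Suc by (auto simp: drop_phase_def)
qed

lemma xbar_eq: "xbar k = mat_vec (cols k) (ybar k)"
  using optimize[of k] by (simp add: optimize_phase_def)

lemma ybar_in_prob_simplex: "ybar k \<in> prob_simplex (length (cols k))"
  using optimize[of k] invariant[of k] df_simplex_result(1) tolerances df_simplex_params
  by (auto simp: optimize_phase_def split: if_splits intro: less_imp_le)

lemma f_xbar_le: "f (xbar k) \<le> f (x k)"
proof (cases "length (cols k) = 1")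
  case True
  then show ?thesis using optimize[of k] invariant[of k] by (simp add: optimize_phase_def)
next
  case False
  then have "obj f (cols k) (ybar k) \<le> obj f (cols k) (y k)"
    using df_simplex_result(2)[of "obj f (cols k)" "length (cols k)" "\<epsilon> k" \<tau> \<theta>\<^sub>S \<gamma>\<^sub>S \<delta> "y k" "ybar k"]
      optimize[of k] tolerances(1)[of k] df_simplex_params by (simp add: optimize_phase_def)
  then show ?thesis using invariant[of k] by (simp add: obj_def xbar_eq)
qed

text \<open>The last inequality of the success case measures the decrease from \<open>x k\<close>,
  via \<open>f_xbar_le\<close>, because differences of consecutive values \<open>f (x k)\<close>
  vanish once \<open>x\<close> converges.\<close>

lemma refine_cases:
  obtains (success) a \<mu> where "a \<in> \<A>" "0 < \<mu>" "x (Suc k) = xbar k + \<mu> *\<^sub>R (a - xbar k)" "R k = {a}"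
      "f (x (Suc k)) \<le> f (xbar k) - \<gamma> * \<mu>\<^sup>2" "\<gamma> * \<mu>\<^sup>2 \<le> f (x k) - f (x (Suc k))"
  | (failure) "x (Suc k) = xbar k" "R k = {}"
proof (cases "\<exists>a \<mu>. refine_ok f \<A> \<gamma> (cols k) (xbar k) (\<mu>hat k) a \<mu>")
  case True
  then obtain a \<mu> where "refine_ok f \<A> \<gamma> (cols k) (xbar k) (\<mu>hat k) a \<mu>"
    "x (Suc k) = xbar k + \<mu> *\<^sub>R (a - xbar k)" "R k = {a}"
    using refine[of k] unfolding refine_phase_def by auto
  then show thesis
    using success[of a \<mu>] invariant[of k] f_xbar_le[of k] by (auto simp: refine_ok_def)
next
  case False
  then show thesis using failure refine[of k] by (simp add: refine_phase_def)
qed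

end

section \<open>Elimination of the atoms with positive slope at the limit\<close>

theorem theorem5:
  fixes \<A> :: "(real ^ 'n) set"
    and f :: "real ^ 'n \<Rightarrow> real" and grad_f :: "real ^ 'n \<Rightarrow> real ^ 'n"
    and \<tau> \<theta>\<^sub>S \<gamma>\<^sub>S \<delta> \<gamma> \<theta> :: real and \<epsilon> \<mu>hat r :: "nat \<Rightarrow> real"
    and cols :: "nat \<Rightarrow> (real ^ 'n) list" and x xbar :: "nat \<Rightarrow> real ^ 'n"
    and y ybar g :: "nat \<Rightarrow> nat \<Rightarrow> real" and R D :: "nat \<Rightarrow> (real ^ 'n) set"
    and xstar :: "real ^ 'n"
  assumes "finite \<A>" and "\<A> \<noteq> {}"
    and "\<And>v. GDERIV f v :> grad_f v" and "continuous_on UNIV grad_f"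
    and "ORD \<A> f \<tau> \<theta>\<^sub>S \<gamma>\<^sub>S \<delta> \<gamma> \<theta> \<epsilon> cols x xbar y ybar \<mu>hat R D"
    and "\<And>k. D k = {a \<in> set (cols k). \<exists>h<length (cols k).
           a = mat_vec (cols k) (basis_vec h) \<and> ybar k h = 0 \<and>
           (\<Sum>i<length (cols k). g k i * (basis_vec h i - ybar k i)) \<ge> 0}"
    and "\<And>k. L2_set (\<lambda>i. grad (obj f (cols k)) (ybar k) i - g k i) {..<length (cols k)} \<le> r k"
    and "\<And>k. r k > 0" and "r \<longlonglongrightarrow> 0"
    and "x \<longlonglongrightarrow> xstar"
  shows "\<exists>kbar. \<forall>k\<ge>kbar. \<forall>a\<in>\<A>. grad_f xstar \<bullet> (a - xstar) > 0 \<longrightarrow> a \<notin> set (cols k)"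
proof -
  interpret ORD \<A> f \<tau> \<theta>\<^sub>S \<gamma>\<^sub>S \<delta> \<gamma> \<theta> \<epsilon> cols x xbar y ybar \<mu>hat R D by fact
  note deriv = assms(3)
  let ?G = "grad_f xstar"
  \<comment> \<open>The bound is kept at least 1 so that \<open>\<eta>\<close> below may be defined
    by dividing by it.\<close>
  obtain B where "1 \<le> B" and B: "\<And>a. a \<in> \<A> \<Longrightarrow> norm a \<le> B"
  proof -
    obtain C where "\<And>a. a \<in> \<A> \<Longrightarrow> norm a \<le> C"
      using finite_imp_bounded[OF \<open>finite \<A>\<close>] by (auto simp: bounded_iff)
    then show thesis using that[of "max 1 C"] by (meson max.cobounded1 max.coboundedI2)
  qed
  have B_cols: "norm a \<le> B" if "a \<in> set (cols k)" for a k
    using B invariant[of k] that by blast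
  have B_xbar: "norm (xbar k) \<le> B" for k
    unfolding xbar_eq by (intro norm_mat_vec_le[OF ybar_in_prob_simplex] B_cols)
  have diam: "norm (a - xbar k) \<le> 2 * B" if "a \<in> \<A>" for a k
    using norm_triangle_ineq4[of a "xbar k"] B[OF that] B_xbar[of k] by linarith

  have "xbar \<longlonglongrightarrow> xstar"
  proof -
    have "(\<lambda>k. f (x k)) \<longlonglongrightarrow> f xstar"
      using isCont_tendsto_compose[OF _ \<open>x \<longlonglongrightarrow> xstar\<close>] has_derivative_continuous deriv[of xstar]
      unfolding gderiv_def by blast
    from tendsto_diff[OF this LIMSEQ_Suc[OF this]]
    have "(\<lambda>k. f (x k) - f (x (Suc k))) \<longlonglongrightarrow> 0" by simp
    then have lim: "(\<lambda>k. 2 * B * sqrt ((f (x k) - f (x (Suc k))) / \<gamma>)) \<longlonglongrightarrow> 0"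
      by (intro tendsto_mult_right_zero tendsto_divide_zero
          tendsto_real_sqrt[where x = 0, unfolded real_sqrt_zero])
    \<comment> \<open>A successful step size is at most the root of the decrease over
      \<open>\<gamma>\<close>. After a failure the left side is 0, and the right side is nonnegative
      since \<open>f (x k)\<close> did not increase.\<close>
    have "norm (x (Suc k) - xbar k) \<le> 2 * B * sqrt ((f (x k) - f (x (Suc k))) / \<gamma>)" for k
    proof (cases rule: refine_cases[of k])
      case (success a \<mu>)
      have "\<mu> \<le> sqrt ((f (x k) - f (x (Suc k))) / \<gamma>)"
        using success(6) ord_params by (intro real_le_rsqrt) (simp add: field_simps)
      then have "norm (a - xbar k) * \<mu> \<le> 2 * B * sqrt ((f (x k) - f (x (Suc k))) / \<gamma>)"
        using diam[OF success(1)] \<open>0 < \<mu>\<close> \<open>1 \<le> B\<close> by (intro mult_mono) auto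
      then show ?thesis using success(2,3) by (simp add: mult.commute)
    next
      case failure
      have "f (x (Suc k)) \<le> f (x k)" using failure f_xbar_le[of k] by simp
      then show ?thesis using failure \<open>1 \<le> B\<close> ord_params by simp
    qed
    then have "(\<lambda>k. x (Suc k) - xbar k) \<longlonglongrightarrow> 0"
      by (rule Lim_null_comparison[OF always_eventually[OF allI] lim])
    from tendsto_diff[OF LIMSEQ_Suc[OF \<open>x \<longlonglongrightarrow> xstar\<close>] this] show ?thesis by simp
  qed

  have gone: "\<forall>\<^sub>F k in sequentially. a \<notin> set (cols k)"
    if a: "a \<in> \<A>" and pos: "?G \<bullet> (a - xstar) > 0" for a
  proof -
    let ?c = "?G \<bullet> (a - xstar)"
    \<comment> \<open>The constant makes \<open>\<eta> * (2 * B)\<close> equal to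
      \<open>?c / 16\<close>. Together with \<open>\<gamma>\<^sub>S * \<epsilon> k < ?c / 16\<close>
      the support bound \<open>2 * (\<gamma>\<^sub>S * \<epsilon> k + \<eta> * (2 * B))\<close>
      stays below \<open>?c / 4\<close>, while the slope at \<open>xbar k\<close> exceeds
      \<open>?c / 2\<close>.\<close>
    define \<eta> where "\<eta> = ?c / (32 * B)"
    have "0 < \<eta>" and \<eta>: "\<eta> * (2 * B) = ?c / 16" using pos \<open>1 \<le> B\<close> by (auto simp: \<eta>_def)
    have "isCont grad_f xstar" using assms(4) by (simp add: continuous_on_eq_continuous_at)
    then obtain \<rho> where "0 < \<rho>" and strict: "\<And>u v. u \<in> ball xstar \<rho> \<Longrightarrow> v \<in> ball xstar \<rho> \<Longrightarrow>
        \<bar>f v - f u - ?G \<bullet> (v - u)\<bar> \<le> \<eta> * norm (v - u)"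
      using C1_strict_derivative[OF deriv _ \<open>0 < \<eta>\<close>] by blast

    note lims = \<open>xbar \<longlonglongrightarrow> xstar\<close> tolerances(3) \<open>r \<longlonglongrightarrow> 0\<close>
      isCont_tendsto_compose[OF \<open>isCont grad_f xstar\<close> \<open>xbar \<longlonglongrightarrow> xstar\<close>]
    have "(\<lambda>k. dist xstar (xbar k) + 2 * B * \<epsilon> k) \<longlonglongrightarrow> dist xstar xstar + 2 * B * 0"
      by (intro tendsto_intros lims)
    then have "\<forall>\<^sub>F k in sequentially. dist xstar (xbar k) + 2 * B * \<epsilon> k < \<rho>"
      using \<open>0 < \<rho>\<close> by (intro order_tendstoD(2)) auto
    moreover have "\<forall>\<^sub>F k in sequentially. x (Suc k) \<in> ball xstar \<rho>"
      using LIMSEQ_Suc[OF \<open>x \<longlonglongrightarrow> xstar\<close>] \<open>0 < \<rho>\<close>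
      by (intro topological_tendstoD[of _ xstar]) auto
    \<comment> \<open>The columns are distinct atoms, so \<open>card \<A>\<close> bounds their
      number uniformly in \<open>k\<close> and one threshold for \<open>\<epsilon> k\<close> serves
      all iterations.\<close>
    moreover have "0 < \<tau> / card \<A>"
      using assms(1,2) df_simplex_params by (simp add: card_gt_0_iff)
    then have "\<forall>\<^sub>F k in sequentially. \<epsilon> k < \<tau> / card \<A>"
      by (rule order_tendstoD(2)[OF tolerances(3)])
    moreover have "(\<lambda>k. \<gamma>\<^sub>S * \<epsilon> k) \<longlonglongrightarrow> \<gamma>\<^sub>S * 0"
      by (intro tendsto_intros lims)
    then have "\<forall>\<^sub>F k in sequentially. \<gamma>\<^sub>S * \<epsilon> k < ?c / 16"
      using pos by (intro order_tendstoD(2)) auto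
    moreover have "(\<lambda>k. ?G \<bullet> (a - xbar k)) \<longlonglongrightarrow> ?c"
      by (intro tendsto_intros lims)
    then have "\<forall>\<^sub>F k in sequentially. ?c / 2 < ?G \<bullet> (a - xbar k)"
      using pos by (intro order_tendstoD(1)) auto
    moreover have "(\<lambda>k. grad_f (xbar k) \<bullet> (a - xbar k) - 2 * r k) \<longlonglongrightarrow> ?c - 2 * 0"
      by (intro tendsto_intros lims)
    then have "\<forall>\<^sub>F k in sequentially. 0 < grad_f (xbar k) \<bullet> (a - xbar k) - 2 * r k"
      using pos by (intro order_tendstoD(1)) auto
    ultimately have "\<forall>\<^sub>F k in sequentially. a \<notin> set (cols (Suc k))"
    proof eventually_elim
      case (elim k)
      have ybar: "ybar k \<in> prob_simplex (length (cols k))" by (rule ybar_in_prob_simplex)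
      \<comment> \<open>Refining towards \<open>a\<close> would not increase \<open>f\<close>, but
        the linear model between \<open>xbar k\<close> and \<open>x (Suc k)\<close>, both close to
        \<open>xstar\<close>, then forces a slope of at most \<open>?c / 16\<close>.\<close>
      have "a \<notin> R k"
      proof (cases rule: refine_cases[of k])
        case (success a' \<mu>)
        have "a' \<noteq> a"
        proof
          assume "a' = a"
          have "0 \<le> 2 * B * \<epsilon> k" using \<open>1 \<le> B\<close> tolerances(1)[of k] by simp
          then have "xbar k \<in> ball xstar \<rho>" using elim(1) by simp
          from strict[OF this elim(2)]
          have "\<mu> * (?G \<bullet> (a - xbar k)) - (f (x (Suc k)) - f (xbar k)) \<le> \<mu> * (\<eta> * norm (a - xbar k))"
            using success(2,3) \<open>a' = a\<close> by (simp add: mult.left_commute)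
          moreover have "f (x (Suc k)) - f (xbar k) \<le> 0"
            using success(5) ord_params by (smt (verit) mult_nonneg_nonneg zero_le_power2)
          ultimately have "?G \<bullet> (a - xbar k) \<le> \<eta> * norm (a - xbar k)"
            using \<open>0 < \<mu>\<close> by (smt (verit) mult_le_cancel_left_pos)
          also have "\<dots> \<le> \<eta> * (2 * B)"
            using diam[OF a] \<open>0 < \<eta>\<close> by (intro mult_left_mono) auto
          finally show False using elim(5) \<eta> pos by simp
        qed
        then show ?thesis using success(4) by simp
      qed simp
      moreover have "a \<in> D k" if mem: "a \<in> set (cols k)"
      proof -
        obtain h where h: "h < length (cols k)" "a = cols k ! h"
          using mem by (metis in_set_conv_nth)
        have "ybar k h = 0"
        proof (rule ccontr)
          assume "ybar k h \<noteq> 0"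
          then have "0 < ybar k h" using prob_simplexD(2)[OF ybar, of h] by simp
          have "?G \<bullet> (a - xbar k) \<le> 2 * (\<gamma>\<^sub>S * \<epsilon> k + \<eta> * (2 * B))"
          proof (cases "length (cols k) = 1")
            \<comment> \<open>With a single column its weight is 1, so \<open>xbar k\<close> is the
              atom itself and the slope is 0.\<close>
            case True
            then have "xbar k = a"
              using h prob_simplexD(1)[OF ybar] by (simp add: xbar_eq mat_vec_def)
            then show ?thesis
              using \<open>0 < \<eta>\<close> \<open>1 \<le> B\<close> tolerances(1)[of k] df_simplex_params by simp
          next
            case False
            then have dfs: "df_simplex (obj f (cols k)) (length (cols k)) (\<epsilon> k) \<tau> \<theta>\<^sub>S \<gamma>\<^sub>S \<delta> (y k) (ybar k)"
              using optimize[of k] by (simp add: optimize_phase_def)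
            have "length (cols k) \<le> card \<A>"
              using invariant[of k] \<open>finite \<A>\<close> by (metis card_mono distinct_card)
            then have "\<tau> / card \<A> \<le> \<tau> / length (cols k)"
              using h df_simplex_params by (intro frac_le) auto
            then have "\<epsilon> k \<le> \<tau> / length (cols k)" using elim(3) by linarith
            then show ?thesis
              unfolding h(2) xbar_eq
              using df_simplex_params tolerances(1)[of k] \<open>0 < \<eta>\<close> \<open>0 < ybar k h\<close> h elim(1) B_cols
              by (intro df_simplex_support_slope[OF dfs _ _ _ _ _ _ _ strict]) (auto simp: xbar_eq)
          qed
          then show False using elim(4,5) \<eta> pos by simp
        qed
        \<comment> \<open>The true slope exceeds the gradient error \<open>2 * r k\<close>, so the
          drop test with \<open>g k\<close> has the right sign.\<close>
        moreover have "(\<Sum>i<length (cols k). g k i * (basis_vec h i - ybar k i)) \<ge> 0"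
          using approx_gradient_slope[OF deriv ybar h(1) assms(7)] elim(6)
          by (simp add: h(2) xbar_eq)
        ultimately show ?thesis
          unfolding assms(6) using h by (auto simp: mat_vec_basis_vec)
      qed
      ultimately show ?case using drop[of k] by (auto simp: drop_phase_def)
    qed
    then show ?thesis by (rule eventually_sequentially_Suc[THEN iffD1])
  qed
  \<comment> \<open>The threshold depends on the atom; finiteness of \<open>\<A>\<close> makes it
    common to all.\<close>
  have "\<forall>\<^sub>F k in sequentially. ?G \<bullet> (a - xstar) > 0 \<longrightarrow> a \<notin> set (cols k)" if "a \<in> \<A>" for a
    using gone[OF that] by (cases "?G \<bullet> (a - xstar) > 0") auto
  then have "\<forall>\<^sub>F k in sequentially. \<forall>a\<in>\<A>. ?G \<bullet> (a - xstar) > 0 \<longrightarrow> a \<notin> set (cols k)"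
    using \<open>finite \<A>\<close> by (intro eventually_ball_finite) auto
  then show ?thesis by (simp add: eventually_sequentially)
qed

end
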